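(* If $(\mathbf{k};\mathbf{m})=(k_1,\dots,k_r;m_1,\dots,m_r)$ is a positive bi-index and $0<t<1$, then $$t^{m_r}\mathrm{Li}^{\mu}(\mathbf{k};\mathbf{m};t)=\int_{\Delta^{|\mathbf{k}|}(t)}\omega^{\mu}_{(\mathbf{k};\mathbf{m})}.$$
   Context: Fix $\mu\in\mathbb{C}$ with $\mathrm{Re}(\mu)>0$. A bi-index $(\mathbf{k};\mathbf{m})\in\mathbb{N}^r\times\mathbb{Q}^r$ is positive if all $m_i>0$; $|\mathbf{k}|=k_1+\dots+k_r$. $\mathrm{Li}^{\mu}(\mathbf{k};\mathbf{m};t)=\sum_{0\le n_1\le\cdots\le n_r}\frac{\mu^rt^{n_r\mu}}{(n_1\mu+m_1)^{k_1}\cdots(n_r\mu+m_r)^{k_r}}$ for $0\le t<1$. For $0<t\le1$, $\Delta^n(t)=\{(t_1,\dots,t_n)\in\mathbb{R}^n:0<t_n<\cdots<t_1<t\}$. Put $\omega_0(t)=\frac{dt}{t}$ and, for $a\in\mathbb{Q}$, $\omega^{(a)}_{1,\mu}(t)=\frac{\mu t^{a}dt}{t(1-t^{\mu})}$. With $n=|\mathbf{k}|$ and $m_0=0$, $\omega^{\mu}_{(\mathbf{k};\mathbf{m})}=\phi_1(t_1)\cdots\phi_n(t_n)$ where the sequence $\phi_n,\phi_{n-1},\dots,\phi_1$ (from innermost variable $t_n$ to outermost $t_1$) is $\omega^{(m_1)}_{1,\mu},\omega_0^{\,k_1-1},\omega^{(m_2-m_1)}_{1,\mu},\omega_0^{\,k_2-1},\dots,\omega^{(m_r-m_{r-1})}_{1,\mu},\omega_0^{\,k_r-1}$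 (here $\omega_0^{\,j}$ means $j$ consecutive copies of $\omega_0$); its integral over $\Delta^n(t)$ is $\int_{0<t_n<\dots<t_1<t}\prod_j f_j(t_j)\,dt_1\cdots dt_n$ where $\phi_j=f_j(t)dt$. E.g. $\omega^\mu_{(2,1,2;m_1,m_2,m_3)}=\omega^{(m_1)}_{1,\mu}(t_5)\omega_0(t_4)\omega^{(m_2-m_1)}_{1,\mu}(t_3)\omega^{(m_3-m_2)}_{1,\mu}(t_2)\omega_0(t_1)$. *)

theory Defs
  imports "HOL-Analysis.Analysis"
begin

text \<open>An index \<open>(k\<^sub>1, \<dots>, k\<^sub>r)\<close> with \<open>r \<ge> 1\<close> is a list, so \<open>k\<^sub>i\<close> is \<open>ks ! (i - 1)\<close>;
  the entries \<open>k\<^sub>i\<close> are positive integers.\<close>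

definition bi_index :: "nat list \<Rightarrow> rat list \<Rightarrow> bool" where
  "bi_index ks ms \<longleftrightarrow> ks \<noteq> [] \<and> length ms = length ks \<and> (\<forall>k\<in>set ks. 1 \<le> k)"

definition positive_bi_index :: "nat list \<Rightarrow> rat list \<Rightarrow> bool" where
  "positive_bi_index ks ms \<longleftrightarrow> bi_index ks ms \<and> (\<forall>m\<in>set ms. 0 < m)"

text \<open>The case distinction makes \<open>t\<^sup>0 = 1\<close> also at \<open>t = 0\<close>, where \<open>0 powr 0 = 0\<close>.\<close>

definition Li_term :: "complex \<Rightarrow> nat list \<Rightarrow> rat list \<Rightarrow> real \<Rightarrow> nat list \<Rightarrow> complex" where
  "Li_term \<mu> ks ms t ns =
     \<mu> ^ length ks * (if last ns = 0 then 1 else complex_of_real t powr (of_nat (last ns) * \<mu>))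
       / (\<Prod>i<length ks. (of_nat (ns ! i) * \<mu> + of_rat (ms ! i)) ^ (ks ! i))"

definition Li_indices :: "nat \<Rightarrow> nat list set" where
  "Li_indices r = {ns. length ns = r \<and> sorted ns}"

definition Li :: "complex \<Rightarrow> nat list \<Rightarrow> rat list \<Rightarrow> real \<Rightarrow> complex" where
  "Li \<mu> ks ms t = (\<Sum>\<^sub>\<infinity>ns\<in>Li_indices (length ks). Li_term \<mu> ks ms t ns)"

text \<open>Points of \<open>\<real>\<^sup>n\<close> are the elements of the product space over the index set \<open>{1..n}\<close>,
  since \<open>n\<close> depends on the index.\<close>

definition simplex_domain :: "nat \<Rightarrow> real \<Rightarrow> (nat \<Rightarrow> real) set" where
  "simplex_domain n t = {x \<in> {1..n} \<rightarrow>\<^sub>E UNIV.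
     (\<forall>j\<in>{1..n}. 0 < x j \<and> x j < t) \<and> (\<forall>i\<in>{1..n}. \<forall>j\<in>{1..n}. i < j \<longrightarrow> x j < x i)}"

text \<open>A one-form \<open>f(t) dt\<close> is represented by its coefficient function \<open>f\<close>.\<close>

definition omega0 :: "real \<Rightarrow> complex" where
  "omega0 t = 1 / complex_of_real t"

definition omega1 :: "complex \<Rightarrow> rat \<Rightarrow> real \<Rightarrow> complex" where
  "omega1 \<mu> a t =
     \<mu> * complex_of_real t powr of_rat a / (complex_of_real t * (1 - complex_of_real t powr \<mu>))"

text \<open>The sequence \<open>\<phi>\<^sub>n, \<dots>, \<phi>\<^sub>1\<close>, innermost form first; \<open>(0 # ms) ! i\<close> is the predecessor of
  \<open>ms ! i\<close>, with \<open>m\<^sub>0 = 0\<close>.\<close>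

definition omega_word :: "complex \<Rightarrow> nat list \<Rightarrow> rat list \<Rightarrow> (real \<Rightarrow> complex) list" where
  "omega_word \<mu> ks ms =
     concat (map (\<lambda>i. omega1 \<mu> (ms ! i - (0 # ms) ! i) # replicate (ks ! i - 1) omega0)
       [0..<length ks])"

definition omega_form :: "complex \<Rightarrow> nat list \<Rightarrow> rat list \<Rightarrow> (nat \<Rightarrow> real) \<Rightarrow> complex" where
  "omega_form \<mu> ks ms x =
     (\<Prod>j\<in>{1..sum_list ks}. (omega_word \<mu> ks ms ! (sum_list ks - j)) (x j))"

end

theory Submission
  imports Defs
begin

text \<open>
  The integral is evaluated one variable at a time, from the innermost form outwards. After each
  form it is, as a function \<open>F\<close> of the upper end point \<open>s\<close>, an absolutely convergent generalised
  power series \<open>\<Sum>\<^sub>i c\<^sub>i s powr e\<^sub>i\<close> whose exponents have real part at least \<open>m > 0\<close>. Integrating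
  \<open>F(s)/s\<close> termwise divides \<open>c\<^sub>i\<close> by \<open>e\<^sub>i\<close>; the form \<open>\<omega>\<^sub>1\<close> first multiplies the series by
  \<open>\<mu> \<Sum>\<^sub>d s powr (d\<mu> + a - 1)\<close>, so that the new index \<open>d\<close> is the increment \<open>n\<^sub>j - n\<^sub>j\<^sub>-\<^sub>1\<close> of
  the summation indices of \<open>Li\<close>. Fubini is justified by the bound
  \<open>C s powr m\<close> on the integral of the absolute values, carried along in the same induction.
\<close>

subsection \<open>Termwise integration\<close>

text \<open>Along \<open>to_nat\<close> the unordered sum becomes a series over the naturals, filled
  up with zeros outside the image of \<open>I\<close>, and \<open>sums_integral\<close> applies to
  that series. The pointwise hypotheses are demanded at every \<open>x\<close>; in the application
  an indicator inside \<open>g\<close> takes care of points outside the interval.\<close>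

lemma has_sum_integral_countable:
  fixes g :: "'i::countable \<Rightarrow> 'a \<Rightarrow> 'b::{banach,second_countable_topology}"
  assumes int: "\<And>i. i \<in> I \<Longrightarrow> integrable M (g i)"
    and sum_int: "(\<lambda>i. \<integral>x. norm (g i x) \<partial>M) summable_on I"
    and abs: "\<And>x. (\<lambda>i. norm (g i x)) summable_on I"
    and G: "\<And>x. ((\<lambda>i. g i x) has_sum G x) I"
  shows "((\<lambda>i. \<integral>x. g i x \<partial>M) has_sum (\<integral>x. G x \<partial>M)) I"
proof -
  have to_UNIV: "((\<lambda>n. if n \<in> to_nat ` I then h (from_nat n) else 0) has_sum S) UNIV
      \<longleftrightarrow> (h has_sum S) I" for h :: "'i \<Rightarrow> 'c::{comm_monoid_add,topological_space}" and S
  proof -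
    have "((\<lambda>n. if n \<in> to_nat ` I then h (from_nat n) else 0) has_sum S) UNIV \<longleftrightarrow>
        ((\<lambda>n. h (from_nat n)) has_sum S) (to_nat ` I)"
      by (rule has_sum_cong_neutral) auto
    also have "\<dots> \<longleftrightarrow> (h has_sum S) I"
      by (subst has_sum_reindex) (auto simp: o_def)
    finally show ?thesis .
  qed
  have to_summable: "summable (\<lambda>n. if n \<in> to_nat ` I then h (from_nat n) else 0)"
    if "h summable_on I" for h :: "'i \<Rightarrow> real"
    using that unfolding summable_on_def to_UNIV[symmetric]
    by (metis has_sum_imp_sums sums_summable)
  define g' where "g' n x = (if n \<in> to_nat ` I then g (from_nat n) x else 0)" for n x
  have int': "integrable M (g' n)" for n
    using int by (cases "n \<in> to_nat ` I") (auto simp: g'_def[abs_def])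
  have norm': "norm (g' n x) = (if n \<in> to_nat ` I then norm (g (from_nat n) x) else 0)" for n x
    by (simp add: g'_def)
  have abs': "summable (\<lambda>n. norm (g' n x))" for x
    unfolding norm' by (rule to_summable[OF abs])
  have int_norm': "(\<integral>x. norm (g' n x) \<partial>M) =
      (if n \<in> to_nat ` I then \<integral>x. norm (g (from_nat n) x) \<partial>M else 0)" for n
    by (simp add: norm')
  have sum_int': "summable (\<lambda>n. \<integral>x. norm (g' n x) \<partial>M)"
    unfolding int_norm' by (rule to_summable[OF sum_int])
  have G': "G x = (\<Sum>n. g' n x)" for x
    using G[of x] unfolding to_UNIV[symmetric] g'_def by (simp add: has_sum_imp_sums sums_unique)
  have "(\<lambda>n. integral\<^sup>L M (g' n)) sums (\<integral>x. G x \<partial>M)"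
    unfolding G' by (rule sums_integral) (use int' abs' sum_int' in auto)
  \<comment> \<open>\<open>sums_integral\<close> yields convergence in one order only; absolute
    convergence upgrades it to an unordered sum.\<close>
  moreover have "summable (\<lambda>n. norm (integral\<^sup>L M (g' n)))"
    by (rule summable_comparison_test'[OF sum_int']) (use int' in auto)
  ultimately have "((\<lambda>n. integral\<^sup>L M (g' n)) has_sum (\<integral>x. G x \<partial>M)) UNIV"
    by (intro norm_summable_imp_has_sum)
  moreover have "integral\<^sup>L M (g' n) = (if n \<in> to_nat ` I then integral\<^sup>L M (g (from_nat n)) else 0)" for n
    by (simp add: g'_def[abs_def])
  ultimately show ?thesis
    using to_UNIV[of "\<lambda>i. integral\<^sup>L M (g i)"] by simp
qed

section \<open>Integrals of real and complex powers over intervals starting at 0\<close>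

lemma norm_of_real_powr:
  "0 < s \<Longrightarrow> norm (complex_of_real s powr e) = s powr Re e"
  by (subst norm_powr_real_powr) auto

text \<open>Away from \<open>s = 0\<close>, where the value is 0, the principal logarithm of a real
  number is the real logarithm of its absolute value, plus \<open>pi * \<i>\<close> on the negative
  axis. The resulting formula has visibly measurable pieces.\<close>

lemma measurable_of_real_powr [measurable]:
  "(\<lambda>s. complex_of_real s powr e) \<in> borel_measurable borel"
proof -
  have "complex_of_real s powr e = (if s = 0 then 0 else
      exp (e * (complex_of_real (ln \<bar>s\<bar>) + (if s < 0 then complex_of_real pi else 0) * \<i>)))" for s
    by (auto simp: powr_def Ln_of_real')
  then show ?thesis
    by (subst measurable_cong) measurable
qed

lemma has_bochner_integral_powr_from_0:
  fixes m t :: real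
  assumes "0 < m" "0 \<le> t"
  shows "has_bochner_integral lborel (\<lambda>s. indicator {0<..<t} s *\<^sub>R s powr (m - 1)) (t powr m / m)"
proof (rule has_bochner_integral_nn_integral)
  have "((\<lambda>s. s powr (m - 1)) has_integral t powr (m - 1 + 1) / (m - 1 + 1)) {0..t}"
    using assms by (intro has_integral_powr_from_0) auto
  then have "((\<lambda>s. s powr (m - 1)) has_integral t powr m / m) {0<..<t}"
    by (simp add: has_integral_Icc_iff_Ioo)
  from nn_integral_has_integral_lebesgue[OF _ this]
  show "(\<integral>\<^sup>+ s. ennreal (indicator {0<..<t} s *\<^sub>R s powr (m - 1)) \<partial>lborel) = ennreal (t powr m / m)"
    by (simp add: ennreal_mult'' ennreal_indicator)
qed (use assms in auto)

text \<open>The antiderivative \<open>s powr e / e\<close> is continuous up to 0 because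
  \<open>Re e\<close> is positive, whereas the integrand may be unbounded there; hence the
  fundamental theorem is used with derivatives in the interior only. Integrability comes from the
  real case, since the norm of the integrand is \<open>s powr (Re e - 1)\<close>.\<close>

lemma has_bochner_integral_complex_powr_from_0:
  fixes e :: complex and t :: real
  assumes "0 < Re e" "0 \<le> t"
  shows "has_bochner_integral lborel
    (\<lambda>s. indicator {0<..<t} s *\<^sub>R complex_of_real s powr (e - 1)) (complex_of_real t powr e / e)"
proof -
  have e: "e \<noteq> 0" using assms by auto
  have "integrable lborel (\<lambda>s. indicator {0<..<t} s *\<^sub>R complex_of_real s powr (e - 1))"
  proof (rule Bochner_Integration.integrable_bound)
    show "integrable lborel (\<lambda>s. indicator {0<..<t} s *\<^sub>R s powr (Re e - 1))"
      using has_bochner_integral_powr_from_0[OF assms] by (simp add: has_bochner_integral_iff)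
    show "AE s in lborel. norm (indicator {0<..<t} s *\<^sub>R complex_of_real s powr (e - 1))
        \<le> norm (indicator {0<..<t} s *\<^sub>R s powr (Re e - 1))"
      by (rule AE_I2) (auto simp: indicator_def norm_of_real_powr)
  qed measurable
  then have si: "set_integrable lborel {0<..<t} (\<lambda>s. complex_of_real s powr (e - 1))"
    by (simp add: set_integrable_def)
  have "((\<lambda>s. complex_of_real s powr (e - 1)) has_integral
      (complex_of_real t powr e / e - complex_of_real 0 powr e / e)) {0..t}"
  proof (rule fundamental_theorem_of_calculus_interior)
    show "continuous_on {0..t} (\<lambda>s. complex_of_real s powr e / e)"
      using assms e by (intro continuous_intros) auto
    fix s assume s: "s \<in> {0<..<t}"
    have "((\<lambda>z. z powr e / e) has_field_derivative complex_of_real s powr (e - 1)) (at (complex_of_real s))"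
      using s e by (auto intro!: derivative_eq_intros has_field_derivative_powr)
    then show "((\<lambda>s. complex_of_real s powr e / e) has_vector_derivative
        complex_of_real s powr (e - 1)) (at s)"
      by (rule has_vector_derivative_real_field)
  qed (use assms in auto)
  then have "((\<lambda>s. complex_of_real s powr (e - 1)) has_integral (complex_of_real t powr e / e)) {0<..<t}"
    by (simp add: has_integral_Icc_iff_Ioo)
  then have "(LINT s:{0<..<t}|lborel. complex_of_real s powr (e - 1)) = complex_of_real t powr e / e"
    using set_borel_integral_eq_integral[OF si] by (simp add: integral_unique)
  with si show ?thesis
    by (simp add: has_bochner_integral_iff set_integrable_def set_lebesgue_integral_def)
qed

subsection \<open>Iterated integrals over the simplex\<close>

text \<open>Allowing any index set instead of \<open>{1..n}\<close> lets variables be added one at a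
  time. Larger indices belong to inner variables, so a new outermost variable receives an index
  below all the others.\<close>

definition decr_simplex :: "nat set \<Rightarrow> real \<Rightarrow> (nat \<Rightarrow> real) set" where
  "decr_simplex A t = {x \<in> A \<rightarrow>\<^sub>E UNIV.
     (\<forall>j\<in>A. 0 < x j \<and> x j < t) \<and> (\<forall>i\<in>A. \<forall>j\<in>A. i < j \<longrightarrow> x j < x i)}"

definition iter_integral :: "(nat \<Rightarrow> real \<Rightarrow> complex) \<Rightarrow> nat set \<Rightarrow> real \<Rightarrow> complex" where
  "iter_integral f A t = (LINT x : decr_simplex A t | Pi\<^sub>M A (\<lambda>_. lborel). \<Prod>j\<in>A. f j (x j))"

text \<open>The value lies in \<open>ennreal\<close>, so that it is meaningful, and Tonelli applies,
  before integrability is known.\<close>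

definition iter_abs_integral :: "(nat \<Rightarrow> real \<Rightarrow> complex) \<Rightarrow> nat set \<Rightarrow> real \<Rightarrow> ennreal" where
  "iter_abs_integral f A t =
     (\<integral>\<^sup>+ x. ennreal (norm (indicator (decr_simplex A t) x *\<^sub>R (\<Prod>j\<in>A. f j (x j)))) \<partial>Pi\<^sub>M A (\<lambda>_. lborel))"

lemma decr_simplex_measurable [measurable]:
  assumes "finite A"
  shows "decr_simplex A t \<in> sets (Pi\<^sub>M A (\<lambda>_. lborel))"
proof -
  have "decr_simplex A t = {x \<in> space (Pi\<^sub>M A (\<lambda>_. lborel)).
     (\<forall>j\<in>A. 0 < x j \<and> x j < t) \<and> (\<forall>i\<in>A. \<forall>j\<in>A. i < j \<longrightarrow> x j < x i)}"
    by (simp add: decr_simplex_def space_PiM)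
  also have "\<dots> \<in> sets (Pi\<^sub>M A (\<lambda>_. lborel))"
    using assms countable_finite[OF assms] by measurable
  finally show ?thesis .
qed

text \<open>The smallest index carries the largest coordinate. So \<open>s\<close> replaces
  \<open>t\<close> as the upper end point for the remaining coordinates, whose bound by
  \<open>t\<close> follows by transitivity.\<close>

lemma decr_simplex_insert:
  assumes "\<And>j. j \<in> A \<Longrightarrow> a < j" and "x \<in> A \<rightarrow>\<^sub>E UNIV"
  shows "x(a := s) \<in> decr_simplex (insert a A) t \<longleftrightarrow> s \<in> {0<..<t} \<and> x \<in> decr_simplex A s"
proof -
  have neq: "j \<noteq> a" "\<not> j < a" if "j \<in> A" for j
    using assms(1)[OF that] by auto
  have "x(a := s) \<in> insert a A \<rightarrow>\<^sub>E UNIV"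
    using assms(2) by (auto simp: PiE_def extensional_def)
  then have "x(a := s) \<in> decr_simplex (insert a A) t \<longleftrightarrow>
      0 < s \<and> s < t \<and> (\<forall>j\<in>A. 0 < x j \<and> x j < t) \<and> (\<forall>j\<in>A. x j < s) \<and>
      (\<forall>i\<in>A. \<forall>j\<in>A. i < j \<longrightarrow> x j < x i)"
    unfolding decr_simplex_def by (simp add: neq assms(1) cong: ball_cong)
  also have "\<dots> \<longleftrightarrow> s \<in> {0<..<t} \<and> x \<in> decr_simplex A s"
    using assms(2) unfolding decr_simplex_def by (auto intro: less_trans)
  finally show ?thesis .
qed

lemma iter_integrand_measurable:
  fixes f :: "nat \<Rightarrow> real \<Rightarrow> complex"
  assumes "finite A" and "\<And>j. j \<in> A \<Longrightarrow> f j \<in> borel_measurable borel"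
  shows "(\<lambda>x. indicator (decr_simplex A t) x *\<^sub>R (\<Prod>j\<in>A. f j (x j)))
    \<in> borel_measurable (Pi\<^sub>M A (\<lambda>_. lborel))"
proof -
  have "(\<lambda>x. f j (x j)) \<in> borel_measurable (Pi\<^sub>M A (\<lambda>_. lborel))" if "j \<in> A" for j
    using assms(2)[OF that] that by measurable
  then show ?thesis
    using assms(1)
    by (auto intro!: borel_measurable_scaleR borel_measurable_indicator borel_measurable_prod decr_simplex_measurable)
qed

lemma set_integrable_iter:
  assumes "finite A" and "\<And>j. j \<in> A \<Longrightarrow> f j \<in> borel_measurable borel"
    and "iter_abs_integral f A t < \<infinity>"
  shows "set_integrable (Pi\<^sub>M A (\<lambda>_. lborel)) (decr_simplex A t) (\<lambda>x. \<Prod>j\<in>A. f j (x j))"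
  unfolding set_integrable_def
  by (rule integrableI_bounded)
     (use assms iter_integrand_measurable in \<open>auto simp: iter_abs_integral_def\<close>)

lemma iter_integrand_insert:
  fixes f :: "nat \<Rightarrow> real \<Rightarrow> complex"
  assumes "finite A" and "\<And>j. j \<in> A \<Longrightarrow> a < j" and "x \<in> A \<rightarrow>\<^sub>E UNIV"
  shows "indicator (decr_simplex (insert a A) t) (x(a := s)) *\<^sub>R (\<Prod>j\<in>insert a A. f j ((x(a := s)) j))
    = (indicator {0<..<t} s *\<^sub>R f a s) * (indicator (decr_simplex A s) x *\<^sub>R (\<Prod>j\<in>A. f j (x j)))"
proof -
  have "a \<notin> A" using assms(2) by blast
  then have "(\<Prod>j\<in>A. f j ((x(a := s)) j)) = (\<Prod>j\<in>A. f j (x j))"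
    by (intro prod.cong) auto
  with \<open>a \<notin> A\<close> show ?thesis
    using assms(1) decr_simplex_insert[OF assms(2,3), where s = s and t = t]
    by (auto simp: indicator_def)
qed

text \<open>Tonelli with the new variable outermost: the factor at \<open>a\<close> does not depend
  on the inner variables, and these see \<open>s\<close> only as their end point.\<close>

lemma iter_abs_integral_insert:
  assumes fin: "finite A" and less: "\<And>j. j \<in> A \<Longrightarrow> a < j"
    and meas: "\<And>j. j \<in> insert a A \<Longrightarrow> f j \<in> borel_measurable borel"
  shows "iter_abs_integral f (insert a A) t =
    (\<integral>\<^sup>+ s. ennreal (norm (indicator {0<..<t} s *\<^sub>R f a s)) * iter_abs_integral f A s \<partial>lborel)"
proof -
  interpret product_sigma_finite "\<lambda>_. lborel :: real measure" by standard
  have a: "a \<notin> A" using less by blast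
  have [measurable]: "(\<lambda>x. indicator (decr_simplex A s) x *\<^sub>R (\<Prod>j\<in>A. f j (x j)))
      \<in> borel_measurable (Pi\<^sub>M A (\<lambda>_. lborel))" for s
    using fin meas by (intro iter_integrand_measurable) auto
  have "iter_abs_integral f (insert a A) t =
    (\<integral>\<^sup>+ s. \<integral>\<^sup>+ x. ennreal (norm (indicator (decr_simplex (insert a A) t) (x(a := s)) *\<^sub>R
        (\<Prod>j\<in>insert a A. f j ((x(a := s)) j)))) \<partial>Pi\<^sub>M A (\<lambda>_. lborel) \<partial>lborel)"
    unfolding iter_abs_integral_def
    by (rule product_nn_integral_insert_rev[OF fin a],
       rule measurable_compose[OF iter_integrand_measurable])
       (use fin meas in auto)
  also have "\<dots> = (\<integral>\<^sup>+ s. \<integral>\<^sup>+ x. ennreal (norm (indicator {0<..<t} s *\<^sub>R f a s)) *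
      ennreal (norm (indicator (decr_simplex A s) x *\<^sub>R (\<Prod>j\<in>A. f j (x j)))) \<partial>Pi\<^sub>M A (\<lambda>_. lborel) \<partial>lborel)"
    by (intro nn_integral_cong)
       (simp only: space_PiM space_lborel space_borel iter_integrand_insert[OF fin less] norm_mult ennreal_mult' norm_ge_zero)
  also have "\<dots> = (\<integral>\<^sup>+ s. ennreal (norm (indicator {0<..<t} s *\<^sub>R f a s)) * iter_abs_integral f A s \<partial>lborel)"
    unfolding iter_abs_integral_def by (intro nn_integral_cong nn_integral_cmult) measurable
  finally show ?thesis .
qed

text \<open>The Fubini counterpart of the preceding recursion; finiteness of the absolute integral
  over the enlarged simplex supplies the integrability.\<close>

lemma iter_integral_insert:
  assumes fin: "finite A" and less: "\<And>j. j \<in> A \<Longrightarrow> a < j"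
    and meas: "\<And>j. j \<in> insert a A \<Longrightarrow> f j \<in> borel_measurable borel"
    and bound: "iter_abs_integral f (insert a A) t < \<infinity>"
  shows "iter_integral f (insert a A) t =
    (\<integral>s. indicator {0<..<t} s *\<^sub>R (f a s * iter_integral f A s) \<partial>lborel)"
proof -
  interpret product_sigma_finite "\<lambda>_. lborel :: real measure" by standard
  interpret A: finite_product_sigma_finite "\<lambda>_. lborel :: real measure" A by standard (rule fin)
  have a: "{a} \<inter> A = {}" using less by blast
  define F where "F x = indicator (decr_simplex (insert a A) t) x *\<^sub>R (\<Prod>j\<in>insert a A. f j (x j))" for x
  have F_int: "integrable (Pi\<^sub>M ({a} \<union> A) (\<lambda>_. lborel)) F"
    using set_integrable_iter[OF _ meas bound] fin by (simp add: set_integrable_def F_def[abs_def])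
  have F_meas [measurable]: "F \<in> borel_measurable (Pi\<^sub>M (insert a A) (\<lambda>_. lborel))"
    using F_int by (simp add: borel_measurable_integrable)
  have inner: "(\<integral>y. F (y(a := s)) \<partial>Pi\<^sub>M A (\<lambda>_. lborel)) =
      indicator {0<..<t} s *\<^sub>R (f a s * iter_integral f A s)" for s
  proof -
    have "(\<integral>y. F (y(a := s)) \<partial>Pi\<^sub>M A (\<lambda>_. lborel)) =
        (\<integral>y. (indicator {0<..<t} s *\<^sub>R f a s) *
          (indicator (decr_simplex A s) y *\<^sub>R (\<Prod>j\<in>A. f j (y j))) \<partial>Pi\<^sub>M A (\<lambda>_. lborel))"
      unfolding F_def
      by (intro Bochner_Integration.integral_cong refl iter_integrand_insert[OF fin less]) (auto simp: space_PiM)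
    also have "\<dots> = (indicator {0<..<t} s *\<^sub>R f a s) * iter_integral f A s"
      unfolding iter_integral_def set_lebesgue_integral_def by (rule integral_mult_right_zero)
    finally show ?thesis by simp
  qed
  have "iter_integral f (insert a A) t = integral\<^sup>L (Pi\<^sub>M ({a} \<union> A) (\<lambda>_. lborel)) F"
    by (simp add: iter_integral_def set_lebesgue_integral_def F_def[abs_def])
  also have "\<dots> = (\<integral>x. (\<integral>y. F (merge {a} A (x, y)) \<partial>Pi\<^sub>M A (\<lambda>_. lborel)) \<partial>Pi\<^sub>M {a} (\<lambda>_. lborel))"
    by (rule product_integral_fold[OF a _ fin F_int]) simp
  \<comment> \<open>Merging a point of the one-variable product with \<open>y\<close> amounts to
    updating \<open>y\<close> at \<open>a\<close>; afterwards the one-variable product measure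
    collapses to \<open>lborel\<close>.\<close>
  also have "\<dots> = (\<integral>x. (\<integral>y. F (y(a := x a)) \<partial>Pi\<^sub>M A (\<lambda>_. lborel)) \<partial>Pi\<^sub>M {a} (\<lambda>_. lborel))"
    using a by (intro Bochner_Integration.integral_cong refl arg_cong[where f = F])
      (auto simp: merge_def space_PiM extensional_def PiE_def fun_eq_iff)
  also have "\<dots> = (\<integral>s. (\<integral>y. F (y(a := s)) \<partial>Pi\<^sub>M A (\<lambda>_. lborel)) \<partial>lborel)"
  proof (rule product_integral_singleton)
    have "(\<lambda>(s, y). F (y(a := s))) \<in> borel_measurable (lborel \<Otimes>\<^sub>M Pi\<^sub>M A (\<lambda>_. lborel))"
      by measurable
    then show "(\<lambda>s. \<integral>y. F (y(a := s)) \<partial>Pi\<^sub>M A (\<lambda>_. lborel)) \<in> borel_measurable lborel"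
      by (rule A.borel_measurable_lebesgue_integral)
  qed
  finally show ?thesis by (simp add: inner)
qed

subsection \<open>Generalised power series\<close>

text \<open>The first conjunct controls absolute values of the integrand, whose iterated integral is not
  the absolute value of \<open>iter_integral\<close>.\<close>

definition iter_series ::
  "(nat \<Rightarrow> real \<Rightarrow> complex) \<Rightarrow> nat set \<Rightarrow> real \<Rightarrow> real \<Rightarrow> 'i set \<Rightarrow> ('i \<Rightarrow> complex) \<Rightarrow> ('i \<Rightarrow> complex) \<Rightarrow> bool"
where
  "iter_series f A T m I c e \<longleftrightarrow>
     (\<exists>C\<ge>0. \<forall>s\<in>{0<..T}. iter_abs_integral f A s \<le> ennreal (C * s powr m)) \<and>
     (\<forall>s\<in>{0<..T}. ((\<lambda>i. c i * complex_of_real s powr e i) has_sum iter_integral f A s) I) \<and>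
     (\<lambda>i. norm (c i) * T powr Re (e i)) summable_on I \<and>
     (\<forall>i\<in>I. m \<le> Re (e i))"

text \<open>One integration step, common to both kinds of forms. The product of the new form with
  the old integral is supplied as a series with exponents \<open>e i - 1\<close>; integrating raises
  each exponent by 1 and divides the coefficient by \<open>e i\<close>. The exponent in the bound on
  \<open>f a\<close> is chosen so that \<open>m\<close> turns into \<open>m'\<close>.\<close>

lemma iter_series_insert:
  fixes I :: "'i::countable set"
  assumes fin: "finite A" and less: "\<And>j. j \<in> A \<Longrightarrow> a < j"
    and meas: "\<And>j. j \<in> insert a A \<Longrightarrow> f j \<in> borel_measurable borel"
    and C: "0 \<le> C" "\<And>s. s \<in> {0<..T} \<Longrightarrow> iter_abs_integral f A s \<le> ennreal (C * s powr m)"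
    and K: "0 \<le> K" "\<And>s. s \<in> {0<..T} \<Longrightarrow> norm (f a s) \<le> K * s powr (m' - m - 1)"
    and sums: "\<And>s. s \<in> {0<..T} \<Longrightarrow>
      ((\<lambda>i. c i * complex_of_real s powr (e i - 1)) has_sum (f a s * iter_integral f A s)) I"
    and summable: "(\<lambda>i. norm (c i) * T powr Re (e i)) summable_on I"
    and m': "0 < m'" "\<And>i. i \<in> I \<Longrightarrow> m' \<le> Re (e i)"
  shows "iter_series f (insert a A) T m' I (\<lambda>i. c i / e i) e"
proof -
  \<comment> \<open>Multiplying the two bounds gives \<open>K * C\<close> and the exponent
    \<open>m' - 1\<close>; integration over the interval from 0 to \<open>t\<close> contributes
    \<open>1 / m'\<close>.\<close>
  have abs_bound: "iter_abs_integral f (insert a A) t \<le> ennreal (K * C / m' * t powr m')"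
    if t: "t \<in> {0<..T}" for t
  proof -
    have "iter_abs_integral f (insert a A) t =
        (\<integral>\<^sup>+ s. ennreal (norm (indicator {0<..<t} s *\<^sub>R f a s)) * iter_abs_integral f A s \<partial>lborel)"
      by (rule iter_abs_integral_insert[OF fin less meas])
    also have "\<dots> \<le> (\<integral>\<^sup>+ s. ennreal (K * C * (indicator {0<..<t} s *\<^sub>R s powr (m' - 1))) \<partial>lborel)"
    proof (rule nn_integral_mono)
      fix s :: real
      show "ennreal (norm (indicator {0<..<t} s *\<^sub>R f a s)) * iter_abs_integral f A s
          \<le> ennreal (K * C * (indicator {0<..<t} s *\<^sub>R s powr (m' - 1)))"
      proof (cases "s \<in> {0<..<t}")
        case True
        then have s: "s \<in> {0<..T}" using t by auto
        have "ennreal (norm (f a s)) * iter_abs_integral f A s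
            \<le> ennreal (K * s powr (m' - m - 1)) * ennreal (C * s powr m)"
          by (intro mult_mono ennreal_leI K C s) auto
        also have "\<dots> = ennreal (K * C * (s powr (m' - m - 1) * s powr m))"
          using K C by (simp add: ennreal_mult' mult_ac)
        also have "s powr (m' - m - 1) * s powr m = s powr (m' - 1)"
          by (simp flip: powr_add)
        finally show ?thesis using True by simp
      qed auto
    qed
    also have "\<dots> = ennreal (K * C * (t powr m' / m'))"
      using has_bochner_integral_powr_from_0[OF m'(1), of t] t K C
      by (subst nn_integral_eq_integral) (auto simp: has_bochner_integral_iff)
    finally show ?thesis by simp
  qed
  have sums': "((\<lambda>i. c i / e i * complex_of_real t powr e i) has_sum iter_integral f (insert a A) t) I"
    if t: "t \<in> {0<..T}" for t
  proof -
    \<comment> \<open>The indicator makes each term vanish outside the interval, so the pointwise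
      convergence hypotheses hold on the whole line.\<close>
    define g where "g i s = c i * (indicator {0<..<t} s *\<^sub>R complex_of_real s powr (e i - 1))" for i s
    have g_norm: "norm (g i s) = norm (c i) * (indicator {0<..<t} s *\<^sub>R s powr (Re (e i) - 1))" for i s
      by (auto simp: g_def norm_mult indicator_def norm_of_real_powr)
    have pos: "0 < Re (e i)" if "i \<in> I" for i
      using m' that by fastforce
    have g_int: "has_bochner_integral lborel (g i) (c i * (complex_of_real t powr e i / e i))"
      if "i \<in> I" for i
      unfolding g_def using pos[OF that] t
      by (intro has_bochner_integral_mult_right has_bochner_integral_complex_powr_from_0) auto
    have g_norm_int: "(\<integral>s. norm (g i s) \<partial>lborel) = norm (c i) * (t powr Re (e i) / Re (e i))"
      if "i \<in> I" for i
      unfolding g_norm using pos[OF that] t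
      by (intro has_bochner_integral_integral_eq has_bochner_integral_mult_right
          has_bochner_integral_powr_from_0) auto
    have g_sum: "((\<lambda>i. \<integral>s. g i s \<partial>lborel) has_sum
        (\<integral>s. indicator {0<..<t} s *\<^sub>R (f a s * iter_integral f A s) \<partial>lborel)) I"
    proof (rule has_sum_integral_countable)
      show "integrable lborel (g i)" if "i \<in> I" for i
        using g_int[OF that] by (simp add: has_bochner_integral_iff)
      \<comment> \<open>The series at \<open>T\<close> is a majorant: positive exponents make the
        powers monotone in the base, and the divisors are at least \<open>m'\<close>.\<close>
      have "(\<lambda>i. norm (c i) * (t powr Re (e i) / Re (e i))) summable_on I"
      proof (rule summable_on_comparison_test)
        show "(\<lambda>i. norm (c i) * T powr Re (e i) * (1 / m')) summable_on I"
          by (rule summable_on_cmult_left[OF summable])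
        fix i assume i: "i \<in> I"
        have "t powr Re (e i) / Re (e i) \<le> T powr Re (e i) / m'"
          using t m'(1) m'(2)[OF i] pos[OF i] by (intro frac_le powr_mono2) auto
        then show "norm (c i) * (t powr Re (e i) / Re (e i)) \<le> norm (c i) * T powr Re (e i) * (1 / m')"
          using mult_left_mono[of _ _ "norm (c i)"] by fastforce
        show "0 \<le> norm (c i) * (t powr Re (e i) / Re (e i))"
          using pos[OF i] by simp
      qed
      then show "(\<lambda>i. \<integral>s. norm (g i s) \<partial>lborel) summable_on I"
        using g_norm_int by (simp cong: summable_on_cong)
      fix s :: real
      show "(\<lambda>i. norm (g i s)) summable_on I"
      proof (cases "s \<in> {0<..<t}")
        case True
        show ?thesis
        proof (rule summable_on_comparison_test)
          \<comment> \<open>For fixed \<open>s\<close> the factor \<open>1 / s\<close> is constant,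
            so the series at \<open>T\<close> still serves as a majorant.\<close>
          show "(\<lambda>i. norm (c i) * T powr Re (e i) * (1 / s)) summable_on I"
            by (rule summable_on_cmult_left[OF summable])
          fix i assume i: "i \<in> I"
          have "s powr (Re (e i) - 1) = s powr Re (e i) / s"
            using True by (simp add: powr_diff)
          also have "\<dots> \<le> T powr Re (e i) / s"
            using True t pos[OF i] by (intro divide_right_mono powr_mono2) auto
          finally show "norm (g i s) \<le> norm (c i) * T powr Re (e i) * (1 / s)"
            unfolding g_norm using True mult_left_mono[of _ _ "norm (c i)"] by fastforce
        qed auto
      next
        case False
        then show ?thesis by (simp add: g_norm)
      qed
      show "((\<lambda>i. g i s) has_sum (indicator {0<..<t} s *\<^sub>R (f a s * iter_integral f A s))) I"
        using sums[of s] t by (cases "s \<in> {0<..<t}") (auto simp: g_def)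
    qed
    have iter: "iter_integral f (insert a A) t =
        (\<integral>s. indicator {0<..<t} s *\<^sub>R (f a s * iter_integral f A s) \<partial>lborel)"
      using abs_bound[OF t] by (intro iter_integral_insert[OF fin less meas]) (auto intro: le_less_trans)
    have "(\<integral>s. g i s \<partial>lborel) = c i / e i * complex_of_real t powr e i" if "i \<in> I" for i
      using has_bochner_integral_integral_eq[OF g_int[OF that]] by simp
    then show ?thesis
      unfolding iter using g_sum by (simp cong: has_sum_cong)
  qed
  have "(\<lambda>i. norm (c i / e i) * T powr Re (e i)) summable_on I"
  proof (rule summable_on_comparison_test)
    show "(\<lambda>i. norm (c i) * T powr Re (e i) * (1 / m')) summable_on I"
      by (rule summable_on_cmult_left[OF summable])
    fix i assume i: "i \<in> I"
    have "norm (c i) / norm (e i) \<le> norm (c i) / m'"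
      using m'(1) m'(2)[OF i] complex_Re_le_cmod[of "e i"] by (intro frac_le) auto
    from mult_right_mono[OF this, of "T powr Re (e i)"]
    show "norm (c i / e i) * T powr Re (e i) \<le> norm (c i) * T powr Re (e i) * (1 / m')"
      by (simp add: norm_divide)
  qed auto
  moreover have "0 \<le> K * C / m'" using K C m' by simp
  ultimately show ?thesis
    unfolding iter_series_def using abs_bound sums' m'(2) by blast
qed

text \<open>The rows are summed first, which is legitimate because the double family is absolutely
  summable on the product set.\<close>

lemma has_sum_times:
  fixes F G :: complex
  assumes f: "(f has_sum F) A" and f_abs: "(\<lambda>x. norm (f x)) summable_on A"
    and g: "(g has_sum G) B" and g_abs: "(\<lambda>y. norm (g y)) summable_on B"
  shows "((\<lambda>(x, y). f x * g y) has_sum (F * G)) (A \<times> B)"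
proof (rule has_sum_SigmaI)
  show "((\<lambda>y. case (x, y) of (x, y) \<Rightarrow> f x * g y) has_sum (f x * G)) B" for x
    using has_sum_cmult_right[OF g] by simp
  show "((\<lambda>x. f x * G) has_sum (F * G)) A"
    by (rule has_sum_cmult_left[OF f])
  obtain N where N: "((\<lambda>y. norm (g y)) has_sum N) B"
    using g_abs by (auto simp: summable_on_def)
  have "(\<lambda>(x, y). norm (f x) * norm (g y)) summable_on A \<times> B"
    by (rule summable_on_SigmaI[where g = "\<lambda>x. norm (f x) * N"])
       (auto intro: has_sum_cmult_right[OF N] summable_on_cmult_left[OF f_abs])
  then have "(\<lambda>p. norm (case p of (x, y) \<Rightarrow> f x * g y)) summable_on A \<times> B"
    by (simp add: case_prod_unfold norm_mult)
  then show "(\<lambda>(x, y). f x * g y) summable_on A \<times> B"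
    by (rule abs_summable_summable)
qed

section \<open>The two forms and their action on series\<close>

lemma of_real_powr_of_nat_mult:
  "0 < s \<Longrightarrow> complex_of_real s powr (of_nat n * z) = (complex_of_real s powr z) ^ n"
  by (simp add: powr_def exp_of_nat_mult[symmetric] mult_ac)

lemma omega0_measurable: "omega0 \<in> borel_measurable borel"
  unfolding omega0_def[abs_def] by measurable

lemma omega1_measurable: "omega1 \<mu> q \<in> borel_measurable borel"
  unfolding omega1_def[abs_def] by measurable

text \<open>The base case: the product measure over no variables is a point mass, so both integrals
  equal 1. The index \<open>i\<close> is left free so that the empty list can be chosen for
  it.\<close>

lemma iter_series_empty: "iter_series f {} T 0 {i} (\<lambda>_. 1) (\<lambda>_. 0)"
proof -
  have D: "decr_simplex {} s = {\<lambda>_. undefined}" for s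
    by (auto simp: decr_simplex_def)
  have "iter_abs_integral f {} s = 1" for s
    unfolding iter_abs_integral_def D PiM_empty
    by (subst nn_integral_count_space_finite) auto
  moreover have "iter_integral f {} s = 1" for s
    unfolding iter_integral_def set_lebesgue_integral_def D PiM_empty
    by (subst lebesgue_integral_count_space_finite) auto
  ultimately show ?thesis
    unfolding iter_series_def
    by (auto intro!: exI[of _ 1] simp: powr_def intro: has_sum_finiteI)
qed

text \<open>Only the series parts mention the index set, and they are invariant under bijections.
  The identity bijection serves to replace coefficients by others that agree on the index
  set.\<close>

lemma iter_series_reindex:
  assumes S: "iter_series f A T m J c' e'" and h: "bij_betw h J I"
    and eq: "\<And>j. j \<in> J \<Longrightarrow> c (h j) = c' j" "\<And>j. j \<in> J \<Longrightarrow> e (h j) = e' j"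
  shows "iter_series f A T m I c e"
proof -
  have "((\<lambda>i. c i * complex_of_real s powr e i) has_sum S) I \<longleftrightarrow>
      ((\<lambda>j. c' j * complex_of_real s powr e' j) has_sum S) J" for s S
    by (subst has_sum_reindex_bij_betw[OF h, symmetric]) (simp add: eq cong: has_sum_cong)
  moreover have "(\<lambda>i. norm (c i) * T powr Re (e i)) summable_on I \<longleftrightarrow>
      (\<lambda>j. norm (c' j) * T powr Re (e' j)) summable_on J"
    by (subst summable_on_reindex_bij_betw[OF h, symmetric]) (simp add: eq cong: summable_on_cong)
  moreover have "(\<forall>i\<in>I. m \<le> Re (e i)) \<longleftrightarrow> (\<forall>j\<in>J. m \<le> Re (e' j))"
    using h eq by (auto simp: bij_betw_def)
  ultimately show ?thesis
    using S by (simp add: iter_series_def)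
qed

text \<open>Multiplication by \<open>1 / s\<close> lowers every exponent by 1, so
  \<open>m' = m\<close> and \<open>K = 1\<close> fit the general step. Positivity of
  \<open>m\<close> rules out the base case, where \<open>m = 0\<close>; it becomes available once an
  \<open>omega1\<close> has been integrated.\<close>

lemma iter_series_omega0:
  fixes I :: "'i::countable set"
  assumes "finite A" "\<And>j. j \<in> A \<Longrightarrow> a < j"
    and "\<And>j. j \<in> insert a A \<Longrightarrow> f j \<in> borel_measurable borel"
    and fa: "f a = omega0" and S: "iter_series f A T m I c e" and m: "0 < m"
  shows "iter_series f (insert a A) T m I (\<lambda>i. c i / e i) e"
proof -
  obtain C where C: "0 \<le> C" "\<And>s. s \<in> {0<..T} \<Longrightarrow> iter_abs_integral f A s \<le> ennreal (C * s powr m)"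
    using S unfolding iter_series_def by blast
  show ?thesis
  proof (rule iter_series_insert[OF assms(1-3) C, where K = 1])
    fix s assume s: "s \<in> {0<..T}"
    then show "norm (f a s) \<le> 1 * s powr (m - m - 1)"
      by (simp add: fa omega0_def norm_divide powr_minus_divide)
    have "((\<lambda>i. omega0 s * (c i * complex_of_real s powr e i)) has_sum
        (omega0 s * iter_integral f A s)) I"
      using S s unfolding iter_series_def by (intro has_sum_cmult_right) blast
    moreover have "omega0 s * (c i * complex_of_real s powr e i) =
        c i * complex_of_real s powr (e i - 1)" for i
      using s by (simp add: omega0_def powr_diff)
    ultimately show "((\<lambda>i. c i * complex_of_real s powr (e i - 1)) has_sum
        (f a s * iter_integral f A s)) I"
      by (simp add: fa)
  qed (use S m in \<open>auto simp: iter_series_def\<close>)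
qed

text \<open>The factor \<open>1 / (1 - s powr \<mu>)\<close> is a geometric series, convergent since
  the norm of its ratio is at most \<open>T powr Re \<mu>\<close>, which is below 1. The rational
  \<open>q\<close> may be negative; what counts is that \<open>m + q\<close> is positive.\<close>

lemma iter_series_omega1:
  fixes I :: "'i::countable set"
  assumes "finite A" "\<And>j. j \<in> A \<Longrightarrow> a < j"
    and "\<And>j. j \<in> insert a A \<Longrightarrow> f j \<in> borel_measurable borel"
    and fa: "f a = omega1 \<mu> q" and S: "iter_series f A T m I c e"
    and m: "0 \<le> m" "0 < m + of_rat q" and \<mu>: "0 < Re \<mu>" and T: "0 < T" "T < 1"
  shows "iter_series f (insert a A) T (m + of_rat q) (I \<times> UNIV)
    (\<lambda>(i, n). c i * \<mu> / (e i + (of_nat n * \<mu> + of_rat q))) (\<lambda>(i, n). e i + (of_nat n * \<mu> + of_rat q))"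
proof -
  define c' where "c' = (\<lambda>(i :: 'i, n :: nat). c i * \<mu>)"
  define e' where "e' = (\<lambda>(i :: 'i, n :: nat). e i + (of_nat n * \<mu> + of_rat q))"
  obtain C where C: "0 \<le> C" "\<And>s. s \<in> {0<..T} \<Longrightarrow> iter_abs_integral f A s \<le> ennreal (C * s powr m)"
    using S unfolding iter_series_def by blast
  have e: "m \<le> Re (e i)" if "i \<in> I" for i
    using S that by (simp add: iter_series_def)
  have summable: "(\<lambda>i. norm (c i) * T powr Re (e i)) summable_on I"
    using S by (simp add: iter_series_def)
  have T\<mu>: "T powr Re \<mu> < 1"
    using powr_less_mono2[of "Re \<mu>" T 1] T \<mu> by simp
  have Re_q: "Re (of_rat q) = of_rat q"
    by (cases q) (simp add: of_rat_rat)
  have s\<mu>: "norm (complex_of_real s powr \<mu>) \<le> T powr Re \<mu>" if "s \<in> {0<..T}" for s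
    using that \<mu> by (auto simp: norm_of_real_powr intro!: powr_mono2)
  have geometric: "((\<lambda>n. \<mu> * complex_of_real s powr (of_nat n * \<mu> + of_rat q - 1)) has_sum omega1 \<mu> q s) UNIV"
      "(\<lambda>n. norm (\<mu> * complex_of_real s powr (of_nat n * \<mu> + of_rat q - 1))) summable_on UNIV"
    if s: "s \<in> {0<..T}" for s
  proof -
    let ?z = "complex_of_real s powr \<mu>"
    have z: "norm ?z < 1" using s\<mu>[OF s] T\<mu> by linarith
    have eq: "\<mu> * complex_of_real s powr (of_nat n * \<mu> + of_rat q - 1) =
        (\<mu> * complex_of_real s powr of_rat q / complex_of_real s) * ?z ^ n" for n
      using s by (simp add: powr_diff powr_add of_real_powr_of_nat_mult)
    have summable_z: "summable (\<lambda>n. norm (?z ^ n))"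
      using z by (simp add: norm_power summable_geometric)
    have "((\<lambda>n. ?z ^ n) has_sum (1 / (1 - ?z))) UNIV"
      by (rule norm_summable_imp_has_sum[OF summable_z geometric_sums[OF z]])
    from has_sum_cmult_right[OF this, of "\<mu> * complex_of_real s powr of_rat q / complex_of_real s"]
    show "((\<lambda>n. \<mu> * complex_of_real s powr (of_nat n * \<mu> + of_rat q - 1)) has_sum omega1 \<mu> q s) UNIV"
      unfolding eq by (simp add: omega1_def)
    have "(\<lambda>n. norm (?z ^ n)) summable_on UNIV"
      using summable_z by (simp add: summable_on_UNIV_nonneg_real_iff)
    then show "(\<lambda>n. norm (\<mu> * complex_of_real s powr (of_nat n * \<mu> + of_rat q - 1))) summable_on UNIV"
      unfolding eq norm_mult by (rule summable_on_cmult_right)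
  qed
  have "iter_series f (insert a A) T (m + of_rat q) (I \<times> UNIV) (\<lambda>p. c' p / e' p) e'"
  proof (rule iter_series_insert[OF assms(1-3) C, where K = "norm \<mu> / (1 - T powr Re \<mu>)"])
    show "0 \<le> norm \<mu> / (1 - T powr Re \<mu>)" using T\<mu> by simp
    show "0 < m + of_rat q" by (rule m)
    show "m + of_rat q \<le> Re (e' p)" if "p \<in> I \<times> UNIV" for p
      using e that \<mu> by (auto simp: e'_def Re_q intro!: add_increasing2)
    fix s assume s: "s \<in> {0<..T}"
    \<comment> \<open>Staying below \<open>T\<close> keeps the denominator away from its zero at
      \<open>s = 1\<close>; this explains the constant \<open>K\<close>.\<close>
    have "1 - T powr Re \<mu> \<le> norm (1 - complex_of_real s powr \<mu>)"
      using s\<mu>[OF s] norm_triangle_ineq2[of 1 "complex_of_real s powr \<mu>"] by simp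
    then have "norm \<mu> * s powr (of_rat q - 1) / norm (1 - complex_of_real s powr \<mu>)
        \<le> norm \<mu> * s powr (of_rat q - 1) / (1 - T powr Re \<mu>)"
      using T\<mu> by (intro frac_le) auto
    moreover have "norm (f a s) = norm \<mu> * s powr (of_rat q - 1) / norm (1 - complex_of_real s powr \<mu>)"
      using s by (simp add: fa omega1_def norm_mult norm_divide norm_of_real_powr Re_q powr_diff)
    ultimately show "norm (f a s) \<le> norm \<mu> / (1 - T powr Re \<mu>) * s powr (m + of_rat q - m - 1)"
      by simp
    have "(\<lambda>i. norm (c i * complex_of_real s powr e i)) summable_on I"
    proof (rule summable_on_comparison_test[OF summable])
      fix i assume "i \<in> I"
      then show "norm (c i * complex_of_real s powr e i) \<le> norm (c i) * T powr Re (e i)"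
        using s m e[of i] by (auto simp: norm_mult norm_of_real_powr intro!: mult_left_mono powr_mono2)
    qed auto
    then have "((\<lambda>(i, n). (c i * complex_of_real s powr e i) *
          (\<mu> * complex_of_real s powr (of_nat n * \<mu> + of_rat q - 1))) has_sum
        (iter_integral f A s * omega1 \<mu> q s)) (I \<times> UNIV)"
      using S s geometric[OF s] by (intro has_sum_times) (auto simp: iter_series_def)
    also have "(\<lambda>(i, n). (c i * complex_of_real s powr e i) *
          (\<mu> * complex_of_real s powr (of_nat n * \<mu> + of_rat q - 1))) =
        (\<lambda>p. c' p * complex_of_real s powr (e' p - 1))"
      by (auto simp: c'_def e'_def fun_eq_iff add_diff_eq[symmetric] simp flip: powr_add)
    finally show "((\<lambda>p. c' p * complex_of_real s powr (e' p - 1)) has_sum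
        (f a s * iter_integral f A s)) (I \<times> UNIV)"
      by (simp add: fa mult.commute)
  next
    \<comment> \<open>The extra factor \<open>T\<close> cancels the shift by -1 in the exponents of
      the geometric expansion.\<close>
    have "(\<lambda>n. norm (\<mu> * complex_of_real T powr (of_nat n * \<mu> + of_rat q - 1)) * T) summable_on UNIV"
      using geometric(2)[of T] T by (intro summable_on_cmult_left) auto
    moreover have "norm (\<mu> * complex_of_real T powr (of_nat n * \<mu> + of_rat q - 1)) * T =
        norm \<mu> * T powr Re (of_nat n * \<mu> + of_rat q)" for n
      using T by (simp add: norm_mult norm_divide norm_of_real_powr powr_diff)
    ultimately obtain N where N: "((\<lambda>n. norm \<mu> * T powr Re (of_nat n * \<mu> + of_rat q)) has_sum N) (UNIV :: nat set)"
      by (auto simp: summable_on_def)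
    have "(\<lambda>(i, n). norm (c i) * T powr Re (e i) * (norm \<mu> * T powr Re (of_nat n * \<mu> + of_rat q)))
        summable_on I \<times> UNIV"
      by (rule summable_on_SigmaI[where g = "\<lambda>i. norm (c i) * T powr Re (e i) * N"])
         (auto intro: has_sum_cmult_right[OF N, simplified] summable_on_cmult_left[OF summable])
    also have "(\<lambda>(i, n). norm (c i) * T powr Re (e i) * (norm \<mu> * T powr Re (of_nat n * \<mu> + of_rat q)))
        = (\<lambda>p. norm (c' p) * T powr Re (e' p))"
      by (auto simp: c'_def e'_def fun_eq_iff norm_mult powr_add)
    finally show "(\<lambda>p. norm (c' p) * T powr Re (e' p)) summable_on I \<times> UNIV" .
  qed
  then show ?thesis
    by (simp add: c'_def e'_def case_prod_unfold)
qed

subsection \<open>Multiple polylogarithms\<close>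

definition Li_coeff :: "complex \<Rightarrow> nat list \<Rightarrow> rat list \<Rightarrow> nat list \<Rightarrow> complex" where
  "Li_coeff \<mu> ks ms ns =
     \<mu> ^ length ks / (\<Prod>i<length ks. (of_nat (ns ! i) * \<mu> + of_rat (ms ! i)) ^ (ks ! i))"

text \<open>With \<open>Li_coeff\<close> this describes the terms of \<open>Li\<close> after
  multiplication by the power of \<open>t\<close> with exponent the last entry of \<open>ms\<close>.
  The prepended 0 encodes the convention that the entry before the first is 0, and gives empty lists
  the exponent 0.\<close>

definition Li_exponent :: "complex \<Rightarrow> rat list \<Rightarrow> nat list \<Rightarrow> complex" where
  "Li_exponent \<mu> ms ns = of_nat (last (0 # ns)) * \<mu> + of_rat (last (0 # ms))"

section \<open>Recursion on the last entry of the bi-index\<close>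

lemma Li_coeff_snoc:
  assumes "length ks = length ms" "length ns = length ks"
  shows "Li_coeff \<mu> (ks @ [k]) (ms @ [m]) (ns @ [n]) =
    Li_coeff \<mu> ks ms ns * \<mu> / (of_nat n * \<mu> + of_rat m) ^ k"
proof -
  have "(\<Prod>i<length ks. (of_nat ((ns @ [n]) ! i) * \<mu> + of_rat ((ms @ [m]) ! i)) ^ ((ks @ [k]) ! i)) =
      (\<Prod>i<length ks. (of_nat (ns ! i) * \<mu> + of_rat (ms ! i)) ^ (ks ! i))"
    using assms by (intro prod.cong) (auto simp: nth_append)
  then show ?thesis
    using assms by (simp add: Li_coeff_def nth_append mult_ac)
qed

text \<open>Each block looks back only to the preceding entry of \<open>ms\<close>, so appending
  leaves the earlier blocks alone. Since the word lists innermost forms first, appending adds outer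
  variables.\<close>

lemma omega_word_snoc:
  assumes "length ms = length ks"
  shows "omega_word \<mu> (ks @ [k]) (ms @ [m]) =
    omega_word \<mu> ks ms @ omega1 \<mu> (m - last (0 # ms)) # replicate (k - 1) omega0"
proof -
  have "(0 # ms @ [m]) ! length ks = last (0 # ms)"
    using assms by (metis append_Cons last_conv_nth length_Cons lessI list.distinct(1) nth_append diff_Suc_1)
  moreover have "(ms @ [m]) ! i - (0 # ms @ [m]) ! i = ms ! i - (0 # ms) ! i" if "i < length ks" for i
    using that assms by (cases i) (auto simp: nth_append)
  ultimately show ?thesis
    using assms by (auto simp: omega_word_def nth_append intro!: arg_cong[where f = concat])
qed

text \<open>A block consists of one \<open>omega1\<close> and \<open>k - 1\<close> copies of
  \<open>omega0\<close>; \<open>1 \<le> k\<close> makes the truncated subtraction exact.\<close>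

lemma length_omega_word:
  assumes "\<forall>k\<in>set ks. 1 \<le> k" "length ms = length ks"
  shows "length (omega_word \<mu> ks ms) = sum_list ks"
  using assms
proof (induction ks arbitrary: ms rule: rev_induct)
  case (snoc k ks)
  then show ?case
    by (cases ms rule: rev_cases) (auto simp: omega_word_snoc)
qed (simp add: omega_word_def)

lemma omega_word_measurable:
  assumes "g \<in> set (omega_word \<mu> ks ms)"
  shows "g \<in> borel_measurable borel"
  using assms omega0_measurable omega1_measurable by (auto simp: omega_word_def)

text \<open>A weakly increasing list is determined by its initial part and the nonnegative last
  increment. For an empty initial part the prepended 0 makes the increment the first entry
  itself.\<close>

lemma bij_betw_Li_indices_Suc:
  "bij_betw (\<lambda>(ns, d). ns @ [last (0 # ns) + d]) (Li_indices r \<times> UNIV) (Li_indices (Suc r))"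
proof (rule bij_betw_byWitness[where f' = "\<lambda>ns. (butlast ns, last ns - last (0 # butlast ns))"])
  have le: "x \<le> last (0 # ns)" if "sorted ns" "x \<in> set ns" for x :: nat and ns
    using that by (induction ns rule: rev_induct) (auto simp: sorted_append)
  show "(\<lambda>(ns, d). ns @ [last (0 # ns) + d]) ` (Li_indices r \<times> UNIV) \<subseteq> Li_indices (Suc r)"
    by (auto simp: Li_indices_def sorted_append simp del: last.simps intro: trans_le_add1[OF le])
  have snoc: "\<exists>ms m. ns = ms @ [m] \<and> length ms = r \<and> sorted ms \<and> last (0 # ms) \<le> m"
    if "ns \<in> Li_indices (Suc r)" for ns
    using that by (cases ns rule: rev_cases) (auto simp: Li_indices_def sorted_append)
  show "\<forall>ns\<in>Li_indices (Suc r). (case (butlast ns, last ns - last (0 # butlast ns)) of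
      (ns, d) \<Rightarrow> ns @ [last (0 # ns) + d]) = ns"
    using snoc by fastforce
  show "(\<lambda>ns. (butlast ns, last ns - last (0 # butlast ns))) ` Li_indices (Suc r) \<subseteq> Li_indices r \<times> UNIV"
    using snoc by (fastforce simp: Li_indices_def)
qed auto

text \<open>The number \<open>n\<close> stays fixed during the induction: the innermost variable
  keeps the index \<open>n\<close>, and appending an entry \<open>k\<close> adds \<open>k\<close>
  variables with smaller indices, the first for \<open>omega1\<close> and the others for
  \<open>omega0\<close>.\<close>

lemma iter_series_Li:
  assumes \<mu>: "0 < Re \<mu>" and T: "0 < T" "T < 1"
    and meas: "\<And>j. j \<in> {0<..n} \<Longrightarrow> f j \<in> borel_measurable borel"
    and "length ms = length ks" "\<forall>k\<in>set ks. 1 \<le> k" "\<forall>m\<in>set ms. 0 < m"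
    and "sum_list ks \<le> n"
    and "\<And>j. j < sum_list ks \<Longrightarrow> f (n - j) = omega_word \<mu> ks ms ! j"
  shows "iter_series f {n - sum_list ks<..n} T (of_rat (last (0 # ms)))
    (Li_indices (length ks)) (Li_coeff \<mu> ks ms) (Li_exponent \<mu> ms)"
  using assms(5-)
proof (induction ks arbitrary: ms rule: rev_induct)
  case Nil
  have "iter_series f {} T 0 {[]} (Li_coeff \<mu> [] []) (Li_exponent \<mu> [])"
    by (rule iter_series_reindex[OF iter_series_empty[of _ _ "[]"], where h = "\<lambda>x. x"])
       (auto simp: Li_coeff_def Li_exponent_def)
  moreover have "Li_indices 0 = {[]}"
    by (auto simp: Li_indices_def)
  ultimately show ?case using Nil by simp
next
  case (snoc k ks)
  obtain ms' m where ms: "ms = ms' @ [m]"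
    using snoc.prems(1) by (cases ms rule: rev_cases) auto
  have len: "length ms' = length ks" and k: "1 \<le> k" and ks: "\<forall>k\<in>set ks. 1 \<le> k"
    and m: "0 < m" and ms': "\<forall>m\<in>set ms'. 0 < m" and n: "sum_list ks + k \<le> n"
    using snoc.prems ms by auto
  note word = omega_word_snoc[OF len] length_omega_word[OF ks len]
  define l where "l = sum_list ks"
  have f_ks: "f (n - j) = omega_word \<mu> ks ms' ! j" if "j < l" for j
    using snoc.prems(5)[of j] that by (simp add: ms word nth_append l_def)
  have f_omega1: "f (n - l) = omega1 \<mu> (m - last (0 # ms'))"
    using snoc.prems(5)[of l] k by (simp add: ms word nth_append l_def)
  have f_omega0: "f (n - (l + Suc j)) = omega0" if "Suc j < k" for j
    using snoc.prems(5)[of "l + Suc j"] that by (simp add: ms word nth_append l_def)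
  have insert_eq: "insert (n - j) {n - j<..n} = {n - Suc j<..n}" if "j < l + k" for j
    using that n by (auto simp: l_def)
  have step_meas: "f i \<in> borel_measurable borel" if "j < l + k" "i \<in> insert (n - j) {n - j<..n}" for i j
    using that n by (intro meas) (auto simp: l_def)
  have IH: "iter_series f {n - l<..n} T (of_rat (last (0 # ms')))
      (Li_indices (length ks)) (Li_coeff \<mu> ks ms') (Li_exponent \<mu> ms')"
    unfolding l_def using n f_ks by (intro snoc.IH len ks ms') (auto simp: l_def)
  have last_nonneg: "0 \<le> last (0 # ms')"
    using ms' by (cases "ms' = []") (auto intro: less_imp_le)
  have rat: "of_rat (last (0 # ms')) + of_rat (m - last (0 # ms')) = real_of_rat m"
    by (simp flip: of_rat_add)
  \<comment> \<open>These are the coefficients after \<open>omega1\<close> and \<open>j\<close>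
    copies of \<open>omega0\<close>. The power is \<open>Suc j\<close> because integrating
    \<open>omega1\<close> already divides once by the exponent.\<close>
  define c where "c j ns = Li_coeff \<mu> ks ms' (butlast ns) * \<mu> / Li_exponent \<mu> ms ns ^ Suc j" for j ns
  have "iter_series f (insert (n - l) {n - l<..n}) T
      (of_rat (last (0 # ms')) + of_rat (m - last (0 # ms'))) (Li_indices (length ks) \<times> UNIV)
      (\<lambda>(ns, d). Li_coeff \<mu> ks ms' ns * \<mu> /
         (Li_exponent \<mu> ms' ns + (of_nat d * \<mu> + of_rat (m - last (0 # ms')))))
      (\<lambda>(ns, d). Li_exponent \<mu> ms' ns + (of_nat d * \<mu> + of_rat (m - last (0 # ms'))))"
    using last_nonneg m k
    by (intro iter_series_omega1 f_omega1 IH \<mu> T step_meas[of l]) (auto simp: rat simp del: last.simps)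
  then have series: "iter_series f (insert (n - l) {n - l<..n}) T (of_rat m) (Li_indices (length ks) \<times> UNIV)
      (\<lambda>(ns, d). Li_coeff \<mu> ks ms' ns * \<mu> /
         (Li_exponent \<mu> ms' ns + (of_nat d * \<mu> + of_rat (m - last (0 # ms')))))
      (\<lambda>(ns, d). Li_exponent \<mu> ms' ns + (of_nat d * \<mu> + of_rat (m - last (0 # ms'))))"
    by (simp only: rat)
  \<comment> \<open>Both parts telescope: \<open>d\<close> is the increment of the summation index,
    and the differences of consecutive entries of \<open>ms\<close> add up to
    \<open>m\<close>.\<close>
  have exponent: "Li_exponent \<mu> ms (ns @ [last (0 # ns) + d]) =
      Li_exponent \<mu> ms' ns + (of_nat d * \<mu> + of_rat (m - last (0 # ms')))" for ns d
    by (simp add: Li_exponent_def ms algebra_simps of_rat_diff)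
  have omega1: "iter_series f (insert (n - l) {n - l<..n}) T (of_rat m)
      (Li_indices (Suc (length ks))) (c 0) (Li_exponent \<mu> ms)"
    by (rule iter_series_reindex[OF series bij_betw_Li_indices_Suc])
       (auto simp: c_def exponent simp del: last.simps)
  have omega0: "iter_series f {n - (l + Suc j)<..n} T (of_rat m)
      (Li_indices (Suc (length ks))) (c j) (Li_exponent \<mu> ms)" if "j < k" for j
    using that
  proof (induction j)
    case 0
    with omega1 show ?case by (simp add: insert_eq k)
  next
    case (Suc j)
    then have j: "l + Suc j < l + k" by simp
    have "iter_series f (insert (n - (l + Suc j)) {n - (l + Suc j)<..n}) T (of_rat m)
      (Li_indices (Suc (length ks))) (\<lambda>ns. c j ns / Li_exponent \<mu> ms ns) (Li_exponent \<mu> ms)"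
      using Suc m by (intro iter_series_omega0 f_omega0 Suc.IH step_meas[OF j]) auto
    moreover have "(\<lambda>ns. c j ns / Li_exponent \<mu> ms ns) = c (Suc j)"
      by (simp add: c_def fun_eq_iff mult_ac)
    ultimately show ?case
      using insert_eq[OF j] by simp
  qed
  \<comment> \<open>After all \<open>k - 1\<close> copies of \<open>omega0\<close> the denominator
    has the power \<open>k\<close> required by \<open>Li_coeff\<close>.\<close>
  have final: "iter_series f {n - (l + k)<..n} T (of_rat m)
      (Li_indices (Suc (length ks))) (c (k - 1)) (Li_exponent \<mu> ms)"
    using omega0[of "k - 1"] k by simp
  have coeff: "Li_coeff \<mu> (ks @ [k]) ms ns = c (k - 1) ns" if ns: "ns \<in> Li_indices (Suc (length ks))" for ns
  proof -
    obtain ns' i where "ns = ns' @ [i]" "length ns' = length ks"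
      using ns by (cases ns rule: rev_cases) (auto simp: Li_indices_def)
    then show ?thesis
      using k len by (simp add: ms c_def Li_coeff_snoc Li_exponent_def del: power_Suc)
  qed
  have "iter_series f {n - (l + k)<..n} T (of_rat m)
      (Li_indices (Suc (length ks))) (Li_coeff \<mu> (ks @ [k]) ms) (Li_exponent \<mu> ms)"
    by (rule iter_series_reindex[OF final, where h = "\<lambda>x. x"]) (auto simp: coeff bij_betw_def)
  then show ?case
    by (simp add: ms l_def)
qed

text \<open>Summability and integrability are asserted along with the identity, since an infinite
  sum and a Lebesgue integral default to 0 where they fail to exist. The series result is applied
  with \<open>T = t\<close> and \<open>n\<close> the total weight, so that the variables are exactly
  those in \<open>{1..n}\<close>.\<close>

theorem theorem2p13:
  fixes \<mu> :: complex and ks :: "nat list" and ms :: "rat list" and t :: real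
  assumes "Re \<mu> > 0"
    and "positive_bi_index ks ms"
    and "0 < t" and "t < 1"
  shows "Li_term \<mu> ks ms t summable_on Li_indices (length ks)
    \<and> set_integrable (Pi\<^sub>M {1..sum_list ks} (\<lambda>_. lborel)) (simplex_domain (sum_list ks) t)
        (omega_form \<mu> ks ms)
    \<and> complex_of_real t powr of_rat (last ms) * Li \<mu> ks ms t =
        (LINT x : simplex_domain (sum_list ks) t | Pi\<^sub>M {1..sum_list ks} (\<lambda>_. lborel).
           omega_form \<mu> ks ms x)"
proof -
  define n where "n = sum_list ks"
  define f where "f j = omega_word \<mu> ks ms ! (n - j)" for j
  have ks: "ks \<noteq> []" "length ms = length ks" "\<forall>k\<in>set ks. 1 \<le> k" "\<forall>m\<in>set ms. 0 < m"
    using assms(2) by (auto simp: positive_bi_index_def bi_index_def)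
  have meas: "f j \<in> borel_measurable borel" if "j \<in> {0<..n}" for j
    unfolding f_def using that ks
    by (intro omega_word_measurable[of _ \<mu> ks ms] nth_mem) (auto simp: length_omega_word n_def)
  have "iter_series f {n - sum_list ks<..n} t (of_rat (last (0 # ms)))
      (Li_indices (length ks)) (Li_coeff \<mu> ks ms) (Li_exponent \<mu> ms)"
    using assms ks meas by (intro iter_series_Li) (auto simp: f_def n_def)
  moreover have "{n - sum_list ks<..n} = {1..n}"
    by (auto simp: n_def)
  ultimately have S: "iter_series f {1..n} t (of_rat (last (0 # ms)))
      (Li_indices (length ks)) (Li_coeff \<mu> ks ms) (Li_exponent \<mu> ms)"
    by simp
  have domain: "simplex_domain (sum_list ks) t = decr_simplex {1..n} t"
    by (simp add: simplex_domain_def decr_simplex_def n_def)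
  have form: "omega_form \<mu> ks ms = (\<lambda>x. \<Prod>j\<in>{1..n}. f j (x j))"
    by (simp add: omega_form_def f_def n_def fun_eq_iff)
  \<comment> \<open>The case distinction in \<open>Li_term\<close> disappears because
    \<open>t\<close> is positive, so that its power with exponent 0 is 1.\<close>
  have term_eq: "complex_of_real t powr of_rat (last ms) * Li_term \<mu> ks ms t ns =
      Li_coeff \<mu> ks ms ns * complex_of_real t powr Li_exponent \<mu> ms ns"
    if "ns \<in> Li_indices (length ks)" for ns
  proof -
    have "ns \<noteq> []" "ms \<noteq> []" using that ks by (auto simp: Li_indices_def)
    then show ?thesis
      using assms(3) by (auto simp: Li_term_def Li_coeff_def Li_exponent_def powr_add)
  qed
  have "((\<lambda>ns. complex_of_real t powr of_rat (last ms) * Li_term \<mu> ks ms t ns) has_sum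
      iter_integral f {1..n} t) (Li_indices (length ks))"
    using S assms(3) by (subst has_sum_cong[OF term_eq]) (auto simp: iter_series_def)
  then have sum: "(Li_term \<mu> ks ms t has_sum
      (iter_integral f {1..n} t / complex_of_real t powr of_rat (last ms))) (Li_indices (length ks))"
    using assms(3) by (drule_tac c = "1 / complex_of_real t powr of_rat (last ms)" in has_sum_cmult_right) simp
  obtain C where "iter_abs_integral f {1..n} t \<le> ennreal C"
    using S assms(3) unfolding iter_series_def by fastforce
  then have "iter_abs_integral f {1..n} t < \<infinity>"
    by (auto intro: le_less_trans)
  then have "set_integrable (Pi\<^sub>M {1..n} (\<lambda>_. lborel)) (decr_simplex {1..n} t) (\<lambda>x. \<Prod>j\<in>{1..n}. f j (x j))"
    using meas by (intro set_integrable_iter) auto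
  moreover have "complex_of_real t powr of_rat (last ms) * Li \<mu> ks ms t = iter_integral f {1..n} t"
    using infsumI[OF sum] assms(3) by (simp add: Li_def)
  ultimately show ?thesis
    unfolding domain form iter_integral_def using sum by (auto simp: summable_on_def n_def)
qed

end
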